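(* Let $\Gamma$ be a group generated by a finite set $X$, let $N \triangleleft \Gamma$ be an Abelian normal subgroup with $\Gamma/N$ amenable, and let $\rho\colon \Gamma \rightarrow \Gamma / N$ be the projection. Then for every positive integer $n$ $$F_{\Gamma}(n)\leq F_{\Gamma/N}(2n)\, \bigl(2 n F_{\Gamma/N}(2n)^2\bigr)^{|X|F_{\Gamma/N}(2n)^2},$$ where $F_\Gamma$ is the F\o lner function of $\Gamma$ with respect to $X$ and $F_{\Gamma/N}$ is the F\o lner function of $\Gamma/N$ with respect to $\rho(X)$.
   Context: For a group $G$ generated by a finite set $S$ and a positive integer $n$, an $n$-F\o lner set of $G$ (with respect to $S$) is a non-empty finite subset $F\subset G$ with $\frac{|F\setminus xF|}{|F|}\le n^{-1}$ for all $x\in S$. $G$ is amenable if it admits $n$-F\o lner sets for all $n$. The F\o lner function of $G$ with respect to $S$ is $F_{G,S}(n):=\min\{|F|:\ F\subset G\text{ is } n\text{-F\o lner}\}$, written $F_G$ when $S$ is clear. *)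

theory Defs
  imports Complex_Main "HOL-Algebra.Coset" "HOL-Algebra.Generated_Groups"
begin

definition folner_set :: "('a, 'b) monoid_scheme \<Rightarrow> 'a set \<Rightarrow> nat \<Rightarrow> 'a set \<Rightarrow> bool" where
  "folner_set G S n F \<longleftrightarrow>
     F \<subseteq> carrier G \<and> finite F \<and> F \<noteq> {} \<and>
     (\<forall>x\<in>S. real (card (F - (x <#\<^bsub>G\<^esub> F))) / real (card F) \<le> 1 / real n)"

definition folner_amenable :: "('a, 'b) monoid_scheme \<Rightarrow> 'a set \<Rightarrow> bool" where
  "folner_amenable G S \<longleftrightarrow> (\<forall>n>0. \<exists>F. folner_set G S n F)"

text \<open>The value below is meaningful only if some n-Folner set exists (otherwise the
  \<open>LEAST\<close> ranges over an empty set of cardinalities); a bound on it should therefore be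
  accompanied by existence of such a set.\<close>

definition folner_function :: "('a, 'b) monoid_scheme \<Rightarrow> 'a set \<Rightarrow> nat \<Rightarrow> nat" where
  "folner_function G S n = (LEAST k. \<exists>F. folner_set G S n F \<and> card F = k)"

end

theory Submission
  imports Defs
begin

text \<open>
  Let \<open>k\<close> be the least size of a \<open>2n\<close>-Folner set \<open>E\<close> of \<open>\<Gamma> / N\<close>, and choose a representative
  \<open>t c\<close> of every coset \<open>c \<in> E\<close>.  If \<open>x \<in> X\<close> moves \<open>d \<in> E\<close> to a coset \<open>c \<in> E\<close>, then
  \<open>x \<cdot> t d = t c \<cdot> s\<close> for some \<open>s \<in> N\<close>.  At most \<open>|X| k\<close> elements \<open>s\<close> arise in this way; let
  \<open>S\<close> be a set of at most that size containing them.  For \<open>A \<subseteq> N\<close> consider the disjoint union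
  \<open>F\<close> of the layers \<open>t c \<cdot> A\<close>.  Part of the layer over \<open>c\<close> is lost in \<open>F - x F\<close> for one of two
  reasons only: either \<open>c\<close> itself lies in the boundary of \<open>E\<close>, or the element of \<open>A\<close> concerned
  lies outside \<open>s A\<close>.  If \<open>A\<close> is \<open>2n\<close>-Folner for \<open>S\<close>, each reason accounts for at most
  \<open>|F| / 2n\<close> elements, so \<open>F\<close> is \<open>n\<close>-Folner (lemma \<open>folner_set_lift\<close>).

  It remains to find a small \<open>A\<close>.  Since \<open>N\<close> is Abelian, one can take the box of all products
  of powers \<open>s\<^sup>j\<close> with \<open>j < 2n\<close>, one power for each \<open>s \<in> S\<close>.  It has at most \<open>(2n)\<^bsup>|S|\<^esup>\<close> elements,
  and relations between the generators, which make it smaller, do not make its boundary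
  relatively larger: along each generator the box is a union of progressions of length \<open>2n\<close>
  (lemma \<open>card_powers_diff_translate\<close>).  Hence \<open>|F| \<le> k (2n)\<^bsup>|X| k\<^esup>\<close>, which is below the
  stated bound because \<open>k \<ge> 1\<close>.
\<close>

section \<open>Boxes in Abelian groups\<close>

definition powers_below :: "('a, 'b) monoid_scheme \<Rightarrow> 'a \<Rightarrow> nat \<Rightarrow> 'a set" where
  "powers_below G b m = (\<lambda>j::nat. b [^]\<^bsub>G\<^esub> j) ` {..<m}"

lemma (in comm_group) set_mult_left_commute:
  assumes "A \<subseteq> carrier G" "B \<subseteq> carrier G" "C \<subseteq> carrier G"
  shows "A <#> (B <#> C) = B <#> (A <#> C)"
proof -
  have "U <#> (V <#> C) \<subseteq> V <#> (U <#> C)" if "U \<subseteq> carrier G" "V \<subseteq> carrier G" for U V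
  proof
    fix y assume "y \<in> U <#> (V <#> C)"
    then obtain u v c where y: "u \<in> U" "v \<in> V" "c \<in> C" "y = u \<otimes> (v \<otimes> c)"
      unfolding set_mult_def by blast
    then have "y = v \<otimes> (u \<otimes> c)"
      using that assms(3) m_lcomm by blast
    with y show "y \<in> V <#> (U <#> C)"
      unfolding set_mult_def by blast
  qed
  with assms show ?thesis by blast
qed

text \<open>
  An element \<open>h\<close> of \<open>A\<close> outside \<open>b A\<close> can only be an initial point of a progression, that is,
  \<open>h \<in> Q\<close>.  So the whole progression \<open>h, b h, \<dots>, b\<^bsup>m-1\<^esup> h\<close> lies in \<open>A\<close>.  The \<open>m\<close> translates of
  \<open>A - b A\<close> obtained in this way are disjoint, since \<open>b\<^sup>i h = b\<^sup>j h'\<close> with \<open>i < j\<close> would give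
  \<open>h = b\<^bsup>j-i\<^esup> h' \<in> b A\<close>.
\<close>

lemma (in group) card_powers_diff_translate:
  assumes b: "b \<in> carrier G" and Q: "Q \<subseteq> carrier G" "finite Q"
    and A: "A = powers_below G b m <#> Q"
  shows "m * card (A - (b <# A)) \<le> card A"
proof -
  have finA: "finite A"
    unfolding A powers_below_def set_mult_def using Q by auto
  have mem: "b [^] j \<otimes> q \<in> A" if "j < m" "q \<in> Q" for j :: nat and q
    using that unfolding A powers_below_def set_mult_def by blast
  have shifted: "b [^] j \<otimes> q \<in> b <# A" if "0 < j" "j \<le> m" "q \<in> Q" for j :: nat and q
  proof -
    obtain i where i: "j = Suc i"
      using \<open>0 < j\<close> gr0_implies_Suc by blast
    have "b [^] j \<otimes> q = b \<otimes> (b [^] i \<otimes> q)"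
      using nat_pow_Suc2[OF b, of i] i b Q(1) \<open>q \<in> Q\<close> m_assoc[of b "b [^] i" q] by auto
    moreover have "b [^] i \<otimes> q \<in> A"
      using that i by (intro mem) auto
    ultimately show ?thesis
      unfolding l_coset_def by blast
  qed
  have boundary: "A - (b <# A) \<subseteq> Q"
  proof
    fix h assume h: "h \<in> A - (b <# A)"
    then obtain j q where jq: "j < m" "q \<in> Q" "h = b [^] (j::nat) \<otimes> q"
      unfolding A powers_below_def set_mult_def by blast
    have "j = 0"
      using shifted[of j q] jq h by fastforce
    with jq Q show "h \<in> Q" by auto
  qed
  let ?f = "\<lambda>(j::nat, h). b [^] j \<otimes> h"
  have no_collision: False
    if "i < j" "j < m" and h: "h \<in> A - (b <# A)" and h': "h' \<in> A - (b <# A)"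
      and eq: "b [^] i \<otimes> h = b [^] j \<otimes> h'" for i j :: nat and h h'
  proof -
    have carr: "h \<in> carrier G" "h' \<in> carrier G" "h' \<in> Q"
      using h h' boundary Q(1) by blast+
    have "b [^] j = b [^] i \<otimes> b [^] (j - i)"
      using b \<open>i < j\<close> by (simp add: nat_pow_mult)
    with eq carr b have "b [^] i \<otimes> h = b [^] i \<otimes> (b [^] (j - i) \<otimes> h')"
      by (simp add: m_assoc)
    with carr b have "h = b [^] (j - i) \<otimes> h'"
      by simp
    with shifted[of "j - i" h'] that(1,2) carr h show False
      by auto
  qed
  have "inj_on ?f ({..<m} \<times> (A - (b <# A)))"
  proof (rule inj_onI)
    fix p p' assume p: "p \<in> {..<m} \<times> (A - (b <# A))" and p': "p' \<in> {..<m} \<times> (A - (b <# A))"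
      and eq: "?f p = ?f p'"
    obtain i h j h' where ij: "p = (i, h)" "p' = (j, h')"
      by fastforce
    then have eq': "b [^] i \<otimes> h = b [^] j \<otimes> h'" using eq by simp
    have "i = j"
      using no_collision[OF _ _ _ _ eq'] no_collision[OF _ _ _ _ eq'[symmetric]] p p' ij
      by (metis lessThan_iff mem_Sigma_iff nat_neq_iff)
    moreover have "h \<in> carrier G" "h' \<in> carrier G"
      using p p' ij boundary Q(1) by blast+
    ultimately show "p = p'"
      using eq' b ij by simp
  qed
  then have "card (?f ` ({..<m} \<times> (A - (b <# A)))) = m * card (A - (b <# A))"
    by (simp add: card_image card_cartesian_product)
  moreover have "?f ` ({..<m} \<times> (A - (b <# A))) \<subseteq> A"
    using mem boundary by auto
  ultimately show ?thesis
    using card_mono[OF finA] by metis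
qed

text \<open>
  The box is built one generator at a time.  Instead of its almost invariance, the induction
  carries the shape \<open>powers_below G b m <#> Q\<close> along each \<open>b\<close>: by commutativity this shape
  survives multiplication by the powers of a further generator, with a larger \<open>Q\<close>.
\<close>

lemma (in comm_group) ex_box:
  assumes "finite S" "S \<subseteq> carrier G" "m > 0"
  shows "\<exists>A. A \<subseteq> carrier G \<and> finite A \<and> A \<noteq> {} \<and> card A \<le> m ^ card S \<and>
    (\<forall>b\<in>S. \<exists>Q\<subseteq>carrier G. finite Q \<and> A = powers_below G b m <#> Q)"
  using assms(1,2)
proof (induction S rule: finite_induct)
  case empty
  show ?case by (rule exI[of _ "{\<one>}"]) simp
next
  case (insert b S)
  then obtain A where A: "A \<subseteq> carrier G" "finite A" "A \<noteq> {}" "card A \<le> m ^ card S"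
    and box: "\<And>s. s \<in> S \<Longrightarrow> \<exists>Q\<subseteq>carrier G. finite Q \<and> A = powers_below G s m <#> Q"
    by (metis insert_subset)
  let ?P = "powers_below G b m"
  have P: "finite ?P" "?P \<noteq> {}" "card ?P \<le> m"
    using \<open>m > 0\<close> card_image_le[of "{..<m}" "\<lambda>j::nat. b [^] j"]
    by (auto simp: powers_below_def)
  have pow_carrier: "powers_below G s m \<subseteq> carrier G" if "s \<in> carrier G" for s
    using that by (auto simp: powers_below_def)
  have b: "b \<in> carrier G" and S: "S \<subseteq> carrier G"
    using insert.prems by auto
  have prod: "?P <#> A = (\<lambda>(p, a). p \<otimes> a) ` (?P \<times> A)"
    by (auto simp: set_mult_def)
  have "card (?P <#> A) \<le> card ?P * card A"
    unfolding prod using card_image_le[of "?P \<times> A"] P A by (simp add: card_cartesian_product)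
  also have "\<dots> \<le> m ^ card (insert b S)"
    using insert.hyps mult_mono[OF P(3) A(4)] by simp
  finally have card: "card (?P <#> A) \<le> m ^ card (insert b S)" .
  have "\<exists>Q\<subseteq>carrier G. finite Q \<and> ?P <#> A = powers_below G s m <#> Q" if "s \<in> insert b S" for s
  proof (cases "s = b")
    case True
    with A show ?thesis by blast
  next
    case False
    with that obtain Q where Q: "Q \<subseteq> carrier G" "finite Q" "A = powers_below G s m <#> Q"
      using box by blast
    have "?P <#> A = powers_below G s m <#> (?P <#> Q)"
      unfolding Q(3) using False that S b Q(1) pow_carrier
      by (intro set_mult_left_commute) auto
    moreover have "finite (?P <#> Q)"
      using P Q by (auto simp: set_mult_def)
    moreover have "?P <#> Q \<subseteq> carrier G"
      by (intro set_mult_closed pow_carrier b Q)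
    ultimately show ?thesis by blast
  qed
  moreover have "?P <#> A \<subseteq> carrier G"
    by (intro set_mult_closed pow_carrier b A)
  moreover have "finite (?P <#> A)" "?P <#> A \<noteq> {}"
    unfolding prod using P A by auto
  ultimately show ?case using card by blast
qed

lemma (in comm_group) ex_folner_set_card_le_power:
  assumes "finite S" "S \<subseteq> carrier G" "m > 0"
  shows "\<exists>A. folner_set G S m A \<and> card A \<le> m ^ card S"
proof -
  obtain A where A: "A \<subseteq> carrier G" "finite A" "A \<noteq> {}" "card A \<le> m ^ card S"
    and box: "\<And>b. b \<in> S \<Longrightarrow> \<exists>Q\<subseteq>carrier G. finite Q \<and> A = powers_below G b m <#> Q"
    using ex_box[OF assms] by blast
  have "real (card (A - (b <# A))) / real (card A) \<le> 1 / real m" if "b \<in> S" for b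
  proof -
    obtain Q where "Q \<subseteq> carrier G" "finite Q" "A = powers_below G b m <#> Q"
      using box \<open>b \<in> S\<close> by blast
    with card_powers_diff_translate[of b Q A m] \<open>b \<in> S\<close> assms(2)
    have "m * card (A - (b <# A)) \<le> card A" by blast
    then have "real m * real (card (A - (b <# A))) \<le> real (card A)"
      by (metis of_nat_le_iff of_nat_mult)
    moreover have "card A > 0"
      using A by (simp add: card_gt_0_iff)
    ultimately show ?thesis
      using \<open>m > 0\<close> by (simp add: field_simps)
  qed
  with A show ?thesis
    unfolding folner_set_def by blast
qed

section \<open>Lifting Folner sets from a quotient\<close>

text \<open>
  Elements of \<open>S\<close> measure how far the section \<open>t\<close> is from commuting with left translation by
  \<open>X\<close>.  Translation by \<open>x\<close> carries the layer \<open>t d <# A\<close> to \<open>t c <# (s <# A)\<close>, where \<open>c\<close> is the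
  translate of \<open>d\<close> and \<open>s \<in> S\<close>, so the tolerance \<open>1/n\<close> splits evenly between
  the boundary of \<open>E\<close> and the boundary of \<open>A\<close>.
\<close>

lemma (in normal) folner_set_lift:
  assumes X: "X \<subseteq> carrier G" and "n > 0"
    and E: "folner_set (G Mod H) ((\<lambda>g. H #> g) ` X) (2 * n) E"
    and t: "\<And>c. c \<in> carrier (G Mod H) \<Longrightarrow> t c \<in> c"
    and S: "\<And>x c. x \<in> X \<Longrightarrow> c \<in> E \<Longrightarrow>
      inv (t ((H #> x) \<otimes>\<^bsub>G Mod H\<^esub> c)) \<otimes> (x \<otimes> t c) \<in> S"
    and A: "folner_set (G\<lparr>carrier := H\<rparr>) S (2 * n) A"
  shows "folner_set G X n (\<Union>c\<in>E. t c <# A) \<and> card (\<Union>c\<in>E. t c <# A) = card E * card A"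
proof -
  let ?F = "\<Union>c\<in>E. t c <# A"
  have Efin: "finite E" "E \<noteq> {}" and Ecos: "E \<subseteq> carrier (G Mod H)"
    using E by (auto simp: folner_set_def)
  have Afin: "finite A" "A \<noteq> {}" and AH: "A \<subseteq> H"
    using A by (auto simp: folner_set_def)
  have Acarr: "A \<subseteq> carrier G" using AH subset by blast
  have coset: "c = H #> t c" "t c \<in> carrier G" if c: "c \<in> carrier (G Mod H)" for c
  proof -
    obtain g where g: "g \<in> carrier G" "c = H #> g"
      using c by (auto simp: FactGroup_def RCOSETS_def)
    have "t c \<in> H #> g" using t[OF c] g by simp
    then show "c = H #> t c"
      using repr_independence[OF _ g(1) is_subgroup] g(2) by simp
    show "t c \<in> carrier G"
      using \<open>t c \<in> H #> g\<close> r_coset_subset_G[OF subset g(1)] by blast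
  qed
  have layer: "t c <# A \<subseteq> c" if "c \<in> carrier (G Mod H)" for c
  proof -
    have "t c <# A \<subseteq> t c <# H" using AH by (auto simp: l_coset_def)
    also have "\<dots> = c" using coset[OF that] coset_eq by metis
    finally show ?thesis .
  qed
  have translate: "t c <# B = (\<lambda>a. t c \<otimes> a) ` B" for c B
    by (auto simp: l_coset_def)
  have card_translate: "card (t c <# B) = card B" if "c \<in> E" "B \<subseteq> carrier G" for c B
  proof -
    have "inj_on (\<lambda>a. t c \<otimes> a) B"
      using that coset(2) Ecos by (intro inj_on_subset[OF inj_on_cmult]) auto
    then show ?thesis unfolding translate by (rule card_image)
  qed
  have disjoint: "(t c <# A) \<inter> (t d <# A) = {}" if "c \<in> E" "d \<in> E" "c \<noteq> d" for c d
  proof -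
    have "c \<in> rcosets H" "d \<in> rcosets H"
      using that Ecos by (auto simp: FactGroup_def)
    then have "c \<inter> d = {}"
      using rcos_disjoint[OF is_subgroup] \<open>c \<noteq> d\<close> by (auto simp: pairwise_def disjnt_def)
    then show ?thesis using layer that Ecos by blast
  qed
  have cardF: "card ?F = card E * card A"
  proof -
    have "card ?F = (\<Sum>c\<in>E. card (t c <# A))"
      using Efin Afin disjoint by (intro card_UN_disjoint) (auto simp: translate)
    also have "\<dots> = card E * card A"
      using card_translate Acarr by simp
    finally show ?thesis .
  qed
  have "real (card (?F - (x <# ?F))) / real (card ?F) \<le> 1 / real n" if x: "x \<in> X" for x
  proof -
    let ?x = "H #> x"
    let ?E' = "E - (?x <#\<^bsub>G Mod H\<^esub> E)"
    have xc: "x \<in> carrier G" using x X by blast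
    have xcos: "?x \<in> carrier (G Mod H)"
      using xc by (auto simp: FactGroup_def RCOSETS_def)
    have "\<exists>s\<in>S. (t c <# A) - (x <# ?F) \<subseteq> t c <# (A - (s <# A))" if c: "c \<in> E" "c \<notin> ?E'" for c
    proof -
      from c obtain d where d: "d \<in> E" "c = ?x \<otimes>\<^bsub>G Mod H\<^esub> d"
        by (auto simp: l_coset_def)
      define s where "s = inv (t c) \<otimes> (x \<otimes> t d)"
      have s: "s \<in> S" using S[OF x d(1)] d(2) by (simp add: s_def)
      have tc: "t c \<in> carrier G" "t d \<in> carrier G"
        using coset(2) c d Ecos by blast+
      then have sc: "s \<in> carrier G" and ts: "t c \<otimes> s = x \<otimes> t d"
        using xc by (simp_all add: s_def m_assoc[symmetric])
      have "t c \<otimes> a \<in> x <# ?F" if "a \<in> s <# A" for a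
      proof -
        from that obtain a' where a': "a' \<in> A" "a = s \<otimes> a'"
          by (auto simp: l_coset_def)
        have "a' \<in> carrier G" using a' Acarr by blast
        then have "t c \<otimes> a = x \<otimes> (t d \<otimes> a')"
          using a'(2) tc sc xc ts by (simp add: m_assoc[symmetric])
        moreover have "t d \<otimes> a' \<in> ?F"
          using a' d by (auto simp: l_coset_def)
        ultimately show ?thesis unfolding l_coset_def by blast
      qed
      then have "(t c <# A) - (x <# ?F) \<subseteq> t c <# (A - (s <# A))"
        unfolding translate by blast
      with s show ?thesis by blast
    qed
    then obtain s where sS: "\<And>c. c \<in> E - ?E' \<Longrightarrow> s c \<in> S"
      and s: "\<And>c. c \<in> E - ?E' \<Longrightarrow> (t c <# A) - (x <# ?F) \<subseteq> t c <# (A - (s c <# A))"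
      by (metis Diff_iff)
    have pos: "real (card E) > 0" "real (card A) > 0"
      using Efin Afin by (simp_all add: card_gt_0_iff)
    have E': "real (card ?E') \<le> real (card E) / real (2 * n)"
    proof -
      have "real (card ?E') / real (card E) \<le> 1 / real (2 * n)"
        using E x unfolding folner_set_def by blast
      with pos show ?thesis by (simp add: field_simps)
    qed
    have AS: "real (card (A - (r <# A))) \<le> real (card A) / real (2 * n)" if "r \<in> S" for r
    proof -
      have "real (card (A - (r <# A))) / real (card A) \<le> 1 / real (2 * n)"
        using A that unfolding folner_set_def by (simp add: l_coset_def)
      with pos show ?thesis by (simp add: field_simps)
    qed
    (* A layer over the boundary of E is given up entirely; elsewhere only the part of A
       outside the translate by s c can be missed. *)
    let ?D = "\<lambda>c. if c \<in> ?E' then t c <# A else t c <# (A - (s c <# A))"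
    have "?F - (x <# ?F) \<subseteq> (\<Union>c\<in>E. ?D c)"
      using s by fastforce
    moreover have "finite (\<Union>c\<in>E. ?D c)"
      using Efin Afin by (auto simp: translate)
    ultimately have "card (?F - (x <# ?F)) \<le> card (\<Union>c\<in>E. ?D c)"
      by (rule card_mono[rotated])
    also have "\<dots> \<le> (\<Sum>c\<in>E. card (?D c))"
      by (rule card_UN_le[OF Efin(1)])
    finally have "real (card (?F - (x <# ?F))) \<le> (\<Sum>c\<in>E. real (card (?D c)))"
      unfolding of_nat_sum[symmetric] of_nat_le_iff .
    also have "\<dots> \<le> (\<Sum>c\<in>E. (if c \<in> ?E' then real (card A) else 0) + real (card A) / real (2 * n))"
    proof (rule sum_mono)
      fix c assume c: "c \<in> E"
      show "real (card (?D c)) \<le> (if c \<in> ?E' then real (card A) else 0) + real (card A) / real (2 * n)"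
      proof (cases "c \<in> ?E'")
        case True
        then show ?thesis using card_translate[OF c Acarr] by (simp only: if_True) simp
      next
        case False
        have "card (t c <# (A - (s c <# A))) = card (A - (s c <# A))"
          using c Acarr by (intro card_translate) auto
        moreover have "s c \<in> S" using False c by (intro sS) blast
        ultimately show ?thesis using False AS[of "s c"] by (simp only: if_False simp_thms add_0)
      qed
    qed
    also have "\<dots> = real (card ?E') * real (card A) + real (card E) * (real (card A) / real (2 * n))"
    proof -
      have "(\<Sum>c\<in>E. if c \<in> ?E' then real (card A) else 0) = (\<Sum>c\<in>E \<inter> ?E'. real (card A))"
        using Efin(1) by (rule sum.inter_restrict[symmetric])
      also have "E \<inter> ?E' = ?E'" by blast
      finally show ?thesis by (simp only: sum.distrib sum_constant)
    qed
    also have "\<dots> \<le> real (card E) / real (2 * n) * real (card A) + real (card E) * (real (card A) / real (2 * n))"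
      by (intro add_right_mono mult_right_mono E') simp
    also have "\<dots> = real (card E * card A) / real n"
      using \<open>n > 0\<close> by (simp add: field_simps)
    finally have "real (card (?F - (x <# ?F))) \<le> real (card ?F) / real n"
      unfolding cardF .
    moreover have "real (card ?F) > 0"
      unfolding cardF using pos by simp
    ultimately show ?thesis using \<open>n > 0\<close> by (simp add: field_simps)
  qed
  moreover have "?F \<subseteq> carrier G"
    using coset(2) Ecos Acarr by (fastforce simp: translate)
  moreover have "finite ?F" "?F \<noteq> {}"
    using Efin Afin by (auto simp: translate)
  ultimately show ?thesis
    unfolding folner_set_def using cardF by blast
qed

section \<open>Extensions with Abelian kernel\<close>

theorem corollary2p3:
  fixes \<Gamma> :: "('a, 'b) monoid_scheme" and X N :: "'a set" and \<rho> :: "'a \<Rightarrow> 'a set" and n :: nat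
  assumes "group \<Gamma>"
    and "finite X" and "X \<subseteq> carrier \<Gamma>" and "generate \<Gamma> X = carrier \<Gamma>"
    and "N \<lhd> \<Gamma>" and "comm_group (\<Gamma>\<lparr>carrier := N\<rparr>)"
    and rho: "\<rho> = (\<lambda>g. N #>\<^bsub>\<Gamma>\<^esub> g)"
    and "folner_amenable (\<Gamma> Mod N) (\<rho> ` X)"
    and "n > 0"
  shows "(\<exists>F. folner_set \<Gamma> X n F) \<and>
    folner_function \<Gamma> X n \<le>
      folner_function (\<Gamma> Mod N) (\<rho> ` X) (2 * n) *
      (2 * n * (folner_function (\<Gamma> Mod N) (\<rho> ` X) (2 * n))\<^sup>2)
        ^ (card X * (folner_function (\<Gamma> Mod N) (\<rho> ` X) (2 * n))\<^sup>2)"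
proof -
  interpret normal N \<Gamma> by fact
  let ?Q = "\<Gamma> Mod N"
  define k where "k = folner_function ?Q (\<rho> ` X) (2 * n)"
  have "\<exists>E. folner_set ?Q (\<rho> ` X) (2 * n) E"
    using assms(8) \<open>n > 0\<close> unfolding folner_amenable_def by simp
  then have "\<exists>E. folner_set ?Q (\<rho> ` X) (2 * n) E \<and> card E = k"
    unfolding k_def folner_function_def
    using LeastI_ex[of "\<lambda>k. \<exists>E. folner_set ?Q (\<rho> ` X) (2 * n) E \<and> card E = k"] by blast
  then obtain E where E: "folner_set ?Q (\<rho> ` X) (2 * n) E" and cardE: "card E = k"
    by blast
  have Efin: "finite E" "E \<noteq> {}" and Ecos: "E \<subseteq> carrier ?Q"
    using E by (auto simp: folner_set_def)
  have "k > 0"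
    using Efin cardE by (auto simp: card_gt_0_iff)
  interpret Q: group ?Q by (rule factorgroup_is_group)
  define t where "t c = (SOME g. g \<in> c)" for c :: "'a set"
  have t: "t c \<in> c" if cq: "c \<in> carrier ?Q" for c
  proof -
    obtain g where "g \<in> carrier \<Gamma>" "c = N #>\<^bsub>\<Gamma>\<^esub> g"
      using cq by (auto simp: FactGroup_def RCOSETS_def)
    then have "g \<in> c" using rcos_self is_subgroup by blast
    then show ?thesis unfolding t_def by (rule someI)
  qed
  (* The defect of the section t: x times t c is the representative of the translated coset
     times a (x, c). *)
  define a where "a = (\<lambda>(x, c). inv\<^bsub>\<Gamma>\<^esub> (t (\<rho> x \<otimes>\<^bsub>?Q\<^esub> c)) \<otimes>\<^bsub>\<Gamma>\<^esub> (x \<otimes>\<^bsub>\<Gamma>\<^esub> t c))"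
  define S where "S = a ` (X \<times> E)"
  have "a (x, c) \<in> N" if x: "x \<in> X" and c: "c \<in> E" for x c
  proof -
    have xc: "x \<in> carrier \<Gamma>" using x assms(3) by blast
    have cq: "c \<in> carrier ?Q" using c Ecos by blast
    have rq: "\<rho> x \<in> carrier ?Q"
      using xc rho by (auto simp: FactGroup_def RCOSETS_def)
    let ?d = "\<rho> x \<otimes>\<^bsub>?Q\<^esub> c"
    have dq: "?d \<in> carrier ?Q" using rq cq by (rule Q.m_closed)
    have "x \<in> \<rho> x" using rho rcos_self[OF xc is_subgroup] by simp
    then have "x \<otimes>\<^bsub>\<Gamma>\<^esub> t c \<in> ?d"
      using t[OF cq] by (auto simp: FactGroup_def set_mult_def)
    moreover have "t ?d \<in> ?d" by (rule t[OF dq])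
    moreover obtain g where g: "g \<in> carrier \<Gamma>" "?d = g <#\<^bsub>\<Gamma>\<^esub> N"
      using dq coset_eq by (auto simp: FactGroup_def RCOSETS_def)
    ultimately obtain u v where uv: "u \<in> N" "v \<in> N"
      "x \<otimes>\<^bsub>\<Gamma>\<^esub> t c = g \<otimes>\<^bsub>\<Gamma>\<^esub> u" "t ?d = g \<otimes>\<^bsub>\<Gamma>\<^esub> v"
      by (auto simp: l_coset_def)
    have carr: "u \<in> carrier \<Gamma>" "v \<in> carrier \<Gamma>" using uv subset by blast+
    have "inv\<^bsub>\<Gamma>\<^esub> g \<otimes>\<^bsub>\<Gamma>\<^esub> (g \<otimes>\<^bsub>\<Gamma>\<^esub> u) = u"
      using carr g(1) by (simp add: m_assoc[symmetric])
    then have "a (x, c) = inv\<^bsub>\<Gamma>\<^esub> v \<otimes>\<^bsub>\<Gamma>\<^esub> u"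
      unfolding a_def prod.case uv(3,4) using carr g(1) by (simp add: inv_mult_group m_assoc)
    then show ?thesis using uv by simp
  qed
  then have SN: "S \<subseteq> N" by (auto simp: S_def)
  have Sfin: "finite S" using Efin assms(2) by (simp add: S_def)
  have cardS: "card S \<le> card X * k"
    unfolding S_def using card_image_le[of "X \<times> E" a] Efin assms(2) cardE
    by (simp add: card_cartesian_product)
  obtain A where A: "folner_set (\<Gamma>\<lparr>carrier := N\<rparr>) S (2 * n) A"
    and cardA: "card A \<le> (2 * n) ^ card S"
    using comm_group.ex_folner_set_card_le_power[OF assms(6) Sfin, of "2 * n"] SN \<open>n > 0\<close>
    by auto
  define F where "F = (\<Union>c\<in>E. t c <#\<^bsub>\<Gamma>\<^esub> A)"
  have F: "folner_set \<Gamma> X n F \<and> card F = card E * card A"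
    unfolding F_def
  proof (rule folner_set_lift[OF assms(3) \<open>n > 0\<close> _ t _ A])
    show "folner_set ?Q ((\<lambda>g. N #>\<^bsub>\<Gamma>\<^esub> g) ` X) (2 * n) E"
      using E rho by simp
    show "inv\<^bsub>\<Gamma>\<^esub> (t ((N #>\<^bsub>\<Gamma>\<^esub> x) \<otimes>\<^bsub>?Q\<^esub> c)) \<otimes>\<^bsub>\<Gamma>\<^esub> (x \<otimes>\<^bsub>\<Gamma>\<^esub> t c) \<in> S"
      if "x \<in> X" "c \<in> E" for x c
      using that unfolding S_def a_def rho by force
  qed
  have "folner_function \<Gamma> X n \<le> card F"
    unfolding folner_function_def using F
      Least_le[of "\<lambda>k. \<exists>F. folner_set \<Gamma> X n F \<and> card F = k" "card F"] by blast
  also have "\<dots> = k * card A" using F cardE by simp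
  also have "\<dots> \<le> k * (2 * n * k\<^sup>2) ^ (card X * k\<^sup>2)"
  proof (rule mult_left_mono)
    have "k \<le> k\<^sup>2" by (simp add: power2_nat_le_imp_le self_le_power power2_eq_square)
    note cardA
    also have "(2 * n) ^ card S \<le> (2 * n) ^ (card X * k\<^sup>2)"
      using cardS \<open>n > 0\<close> mult_le_mono2[OF \<open>k \<le> k\<^sup>2\<close>, of "card X"]
      by (intro power_increasing) linarith+
    also have "\<dots> \<le> (2 * n * k\<^sup>2) ^ (card X * k\<^sup>2)"
      using \<open>k > 0\<close> by (intro power_mono) auto
    finally show "card A \<le> (2 * n * k\<^sup>2) ^ (card X * k\<^sup>2)" .
  qed simp
  finally show ?thesis
    using F unfolding k_def by blast
qed

end
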